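(* The sequences $(\omega(n))_{n\geq 1}$ and $(\Omega(n))_{n\geq 1}$ are not $k$-regular for any integer $k\geq 2$, where $\omega(n)$ is the number of distinct prime divisors of $n$ and $\Omega(n)$ the number of prime divisors of $n$ counted with multiplicity.
   Context: An integer sequence $(s(n))$ is $k$-regular if its $k$-kernel $\{(s(k^l n+r))_{n}: l\geq 0,\ 0\leq r<k^l\}$ is contained in the $\mathbb{Z}$-linear span of finitely many integer sequences. *)

theory Defs
  imports
    Complex_Main
    "HOL-Library.Function_Algebras"
    "HOL-Computational_Algebra.Primes"
begin

interpretation int_seq: module "\<lambda>(c::int) (f::nat \<Rightarrow> int) n. c * f n"
  by unfold_locales (auto simp: fun_eq_iff algebra_simps)

definition k_kernel :: "nat \<Rightarrow> (nat \<Rightarrow> int) \<Rightarrow> (nat \<Rightarrow> int) set" where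
  "k_kernel k s = {(\<lambda>n. s (k ^ l * n + r)) | l r. r < k ^ l}"

definition k_regular :: "nat \<Rightarrow> (nat \<Rightarrow> int) \<Rightarrow> bool" where
  "k_regular k s \<longleftrightarrow> (\<exists>G. finite G \<and> k_kernel k s \<subseteq> int_seq.span G)"

definition little_omega :: "nat \<Rightarrow> nat" where
  "little_omega n = card (prime_factors n)"

definition big_omega :: "nat \<Rightarrow> nat" where
  "big_omega n = size (prime_factorization n)"

end

theory Submission
  imports Defs "HOL-Number_Theory.Cong" "HOL-Number_Theory.Prime_Powers"
begin

text \<open>
  Both functions have the form $n \mapsto \#\{u \in U : u \mid n\}$ with $U$ a set of prime powers
  containing all primes. Averaged over a long progression $Xm + Y$, such a function equals
  $W$ plus the number of $u \in U$ that share a factor with $X$ and divide the progression, up to a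
  bounded error; here $W$ depends on $X$ and the length only, since a $u$ prime to $X$
  divides about one $u$-th of the terms whatever $Y$ is.

  Regularity would give a nontrivial relation $\sum_i c_i s(k^l n + r_i) = 0$ with $r_i = 1 + ki$.
  By the Chinese remainder theorem, $n$ can be restricted to a residue class in which $k^l n + r_j$ is
  divisible by $t$ prescribed large primes (each exactly once) and the other terms by none of them, and
  to a second class where none of the terms is. Comparing the averages of the relation over
  both classes yields $t\,|c_j| = O(\sum_i |c_i|)$ uniformly in $t$, so $c_j = 0$.
\<close>

section \<open>Linear dependence over the integers\<close>

text \<open>Fraction-free Gaussian elimination, one equation per induction step. Cross-multiplying
  replaces division by the pivot, so integer coefficients give an integer solution.\<close>

lemma exists_nontrivial_solution:
  fixes A :: "'i \<Rightarrow> 'g \<Rightarrow> 'a::idom"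
  assumes "finite G" "finite I" "card G < card I"
  shows "\<exists>c. (\<exists>i\<in>I. c i \<noteq> 0) \<and> (\<forall>g\<in>G. (\<Sum>i\<in>I. c i * A i g) = 0)"
  using assms
proof (induction G arbitrary: I A rule: finite_induct)
  case empty
  then obtain i where "i \<in> I" by fastforce
  then show ?case by (intro exI[of _ "\<lambda>_. 1"]) auto
next
  case (insert g G)
  show ?case
  proof (cases "\<forall>i\<in>I. A i g = 0")
    case True
    have "card G < card I" using insert by simp
    from insert.IH[OF insert.prems(1) this] obtain c where
      "\<exists>i\<in>I. c i \<noteq> 0" "\<forall>g\<in>G. (\<Sum>i\<in>I. c i * A i g) = 0" by blast
    with True show ?thesis by (intro exI[of _ c]) auto
  next
    case False
    then obtain j where j: "j \<in> I" "A j g \<noteq> 0" by blast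
    have "card G < card (I - {j})" using insert j by simp
    from insert.IH[OF _ this, of "\<lambda>i h. A j g * A i h - A i g * A j h"] insert.prems(1)
    obtain c where c: "\<exists>i\<in>I-{j}. c i \<noteq> 0"
      "\<And>h. h \<in> G \<Longrightarrow> (\<Sum>i\<in>I-{j}. c i * (A j g * A i h - A i g * A j h)) = 0" by auto
    \<comment> \<open>Scaling by the pivot \<open>A j g\<close> makes back-substitution for the
      unknown \<open>j\<close> free of division. The reduced coefficients vanish identically at
      \<open>h = g\<close>, so equation \<open>g\<close> holds too, and the nonzero pivot keeps the
      solution nontrivial.\<close>
    define c' where "c' = (\<lambda>i. if i = j then - (\<Sum>i\<in>I-{j}. c i * A i g) else c i * A j g)"
    have sum_c': "(\<Sum>i\<in>I. c' i * A i h) = (\<Sum>i\<in>I-{j}. c i * (A j g * A i h - A i g * A j h))" for h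
    proof -
      have "(\<Sum>i\<in>I. c' i * A i h) = c' j * A j h + (\<Sum>i\<in>I-{j}. c' i * A i h)"
        using insert.prems(1) j(1) by (rule sum.remove)
      also have "(\<Sum>i\<in>I-{j}. c' i * A i h) = (\<Sum>i\<in>I-{j}. c i * A j g * A i h)"
        by (intro sum.cong) (auto simp: c'_def)
      also have "c' j * A j h = - (\<Sum>i\<in>I-{j}. c i * A i g * A j h)"
        by (simp add: c'_def sum_distrib_right)
      finally show ?thesis
        by (simp add: sum_subtractf algebra_simps)
    qed
    have "\<exists>i\<in>I. c' i \<noteq> 0"
      using c(1) j by (auto simp: c'_def)
    moreover have "(\<Sum>i\<in>I. c' i * A i h) = 0" if "h \<in> insert g G" for h
      using that c(2) unfolding sum_c' by (auto simp: mult.commute)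
    ultimately show ?thesis by blast
  qed
qed

text \<open>Expanding each \<open>f i\<close> in the generators turns the relation into one linear
  equation per generator, hence fewer equations than unknowns.\<close>

lemma int_seq_span_dependent:
  fixes f :: "'i \<Rightarrow> nat \<Rightarrow> int"
  assumes "finite G" "finite I" "card G < card I" "\<And>i. i \<in> I \<Longrightarrow> f i \<in> int_seq.span G"
  shows "\<exists>c. (\<exists>i\<in>I. c i \<noteq> 0) \<and> (\<forall>n. (\<Sum>i\<in>I. c i * f i n) = 0)"
proof -
  have sum_app: "(\<Sum>g\<in>H. F g) n = (\<Sum>g\<in>H. F g n)"
    for F :: "(nat \<Rightarrow> int) \<Rightarrow> nat \<Rightarrow> int" and H n
    by (induction H rule: infinite_finite_induct) auto
  have "\<exists>u. \<forall>n. f i n = (\<Sum>g\<in>G. u g * g n)" if "i \<in> I" for i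
    using assms(4)[OF that] unfolding int_seq.span_finite[OF assms(1)]
    by (auto simp: sum_app)
  then obtain A where A: "\<And>i n. i \<in> I \<Longrightarrow> f i n = (\<Sum>g\<in>G. A i g * g n)" by metis
  from exists_nontrivial_solution[OF assms(1-3), of A] obtain c where
    c: "\<exists>i\<in>I. c i \<noteq> 0" "\<And>g. g \<in> G \<Longrightarrow> (\<Sum>i\<in>I. c i * A i g) = 0" by blast
  have "(\<Sum>i\<in>I. c i * f i n) = 0" for n
  proof -
    have "(\<Sum>i\<in>I. c i * f i n) = (\<Sum>i\<in>I. \<Sum>g\<in>G. c i * A i g * g n)"
      by (intro sum.cong) (simp_all add: A sum_distrib_left mult.assoc)
    also have "\<dots> = (\<Sum>g\<in>G. (\<Sum>i\<in>I. c i * A i g) * g n)"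
      by (subst sum.swap) (simp add: sum_distrib_right)
    also have "\<dots> = 0" using c(2) by simp
    finally show ?thesis .
  qed
  with c(1) show ?thesis by blast
qed

section \<open>Counting multiples along an arithmetic progression\<close>

lemma card_residue_class_bounds:
  fixes u c M :: nat
  assumes "c < u"
  shows "M div u \<le> card {m. m < M \<and> m mod u = c}"
    and "card {m. m < M \<and> m mod u = c} \<le> M div u + 1"
proof -
  have eq: "{m. m < M \<and> m mod u = c} = (\<lambda>j. c + u * j) ` {j. c + u * j < M}"
  proof (intro set_eqI iffI)
    fix m assume m: "m \<in> {m. m < M \<and> m mod u = c}"
    then have "m = c + u * (m div u)" by (metis (mono_tags) mem_Collect_eq mod_mult_div_eq)
    with m show "m \<in> (\<lambda>j. c + u * j) ` {j. c + u * j < M}"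
      by (metis (mono_tags, lifting) image_eqI mem_Collect_eq)
  qed (use assms in auto)
  have card_eq: "card {m. m < M \<and> m mod u = c} = card {j. c + u * j < M}"
    unfolding eq using assms by (intro card_image) (auto simp: inj_on_def)
  have sup: "{j. c + u * j < M} \<subseteq> {..M div u}"
  proof
    fix j assume "j \<in> {j. c + u * j < M}"
    then have "u * j \<le> M" by simp
    then show "j \<in> {..M div u}" using assms by (simp add: less_eq_div_iff_mult_less_eq mult.commute)
  qed
  have "{..<M div u} \<subseteq> {j. c + u * j < M}"
  proof
    fix j assume "j \<in> {..<M div u}"
    then have "u * (j + 1) \<le> u * (M div u)" by (intro mult_left_mono) auto
    also have "\<dots> \<le> M" by simp
    finally show "j \<in> {j. c + u * j < M}" using assms by simp
  qed
  from card_mono[OF finite_subset[OF sup] this] show "M div u \<le> card {m. m < M \<and> m mod u = c}"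
    using card_eq by simp
  from card_mono[OF _ sup] show "card {m. m < M \<and> m mod u = c} \<le> M div u + 1"
    using card_eq by simp
qed

text \<open>As \<open>X\<close> is invertible modulo \<open>u\<close>, the condition on
  \<open>m\<close> is membership in a single residue class. That the bounds do not involve
  \<open>Y\<close> is what later lets the contribution \<open>W\<close> cancel.\<close>

lemma card_dvd_linear_bounds:
  fixes u X Y M :: nat
  assumes "coprime u X" "u > 0"
  shows "M div u \<le> card {m. m < M \<and> u dvd X * m + Y}"
    and "card {m. m < M \<and> u dvd X * m + Y} \<le> M div u + 1"
proof -
  obtain x where x: "[X * x = 1] (mod u)"
    using cong_solve_coprime_nat[of X u] assms by (auto simp: coprime_commute)
  \<comment> \<open>Here \<open>x\<close> inverts \<open>X\<close> modulo \<open>u\<close>, and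
    \<open>(u - 1) * Y\<close> stands for \<open>-Y\<close> within the naturals.\<close>
  define m0 where "m0 = x * ((u - 1) * Y)"
  have "[X * m0 + Y = 1 * ((u - 1) * Y) + Y] (mod u)"
    unfolding m0_def mult.assoc[symmetric] using x by (intro cong_add cong_mult) auto
  also have "1 * ((u - 1) * Y) + Y = u * Y" using assms(2) by (cases u) auto
  finally have "[X * m0 + Y = 0] (mod u)" by (simp add: cong_def)
  then have "u dvd X * m + Y \<longleftrightarrow> [X * m + Y = X * m0 + Y] (mod u)" for m
    unfolding cong_0_iff[symmetric] by (meson cong_sym cong_trans)
  also have "\<dots> m \<longleftrightarrow> m mod u = m0 mod u" for m
    using assms by (simp add: cong_add_rcancel_nat cong_mult_lcancel_nat coprime_commute cong_def[of m])
  finally have eq: "{m. m < M \<and> u dvd X * m + Y} = {m. m < M \<and> m mod u = m0 mod u}" by blast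
  show "M div u \<le> card {m. m < M \<and> u dvd X * m + Y}"
    and "card {m. m < M \<and> u dvd X * m + Y} \<le> M div u + 1"
    unfolding eq using assms(2) by (intro card_residue_class_bounds; simp)+
qed

lemma sum_card_swap:
  assumes "finite A" "finite B"
  shows "(\<Sum>m\<in>A. card {u\<in>B. R u m}) = (\<Sum>u\<in>B. card {m\<in>A. R u m})"
proof -
  have "(\<Sum>m\<in>A. card {u\<in>B. R u m}) = (\<Sum>m\<in>A. \<Sum>u\<in>B. if R u m then 1 else 0)"
    using assms(2) by (simp add: sum.If_cases Int_def)
  also have "\<dots> = (\<Sum>u\<in>B. \<Sum>m\<in>A. if R u m then 1 else 0)" by (rule sum.swap)
  finally show ?thesis using assms(1) by (simp add: sum.If_cases Int_def)
qed

section \<open>Prime and prime power divisors\<close>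

lemma little_omega_eq_card: "n > 0 \<Longrightarrow> little_omega n = card {u. prime u \<and> u dvd n}"
  by (simp add: little_omega_def prime_factors_dvd)

text \<open>A prime \<open>p\<close> of multiplicity \<open>e\<close> in \<open>n\<close> accounts
  for exactly the prime power divisors \<open>p\<close>, ..., \<open>p ^ e\<close>.\<close>

lemma big_omega_eq_card:
  assumes "n > 0"
  shows "big_omega n = card {u. primepow u \<and> u dvd n}"
proof -
  have "big_omega n = size (image_mset aprimedivisor (mset_set (primepow_factors n)))"
    using assms by (simp add: big_omega_def aprimedivisor_primepow_factors_conv_prime_factorization)
  then show ?thesis by (simp add: primepow_factors_def)
qed

lemma card_proper_primepow_le:
  fixes s Z :: nat
  assumes "Z < (s + 1)\<^sup>2"
  shows "finite {u. primepow u \<and> \<not> prime u \<and> u \<le> Z}"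
    and "card {u. primepow u \<and> \<not> prime u \<and> u \<le> Z} \<le> 2 * s"
proof -
  \<comment> \<open>$p^{2f} = v^2$ and $p^{2f+1} = v^2 p$ for $v = p^f$, and $p$ can be recovered from $v$.\<close>
  define g where "g = (\<lambda>v::nat. v\<^sup>2 * aprimedivisor v)"
  have sub: "{u. primepow u \<and> \<not> prime u \<and> u \<le> Z} \<subseteq> (\<lambda>v. v\<^sup>2) ` {1..s} \<union> g ` {1..s}"
  proof
    fix u assume "u \<in> {u. primepow u \<and> \<not> prime u \<and> u \<le> Z}"
    then obtain p e where u: "prime p" "e > 0" "u = p ^ e" "\<not> prime u" "u \<le> Z"
      by (auto simp: primepow_def)
    from u have "e \<noteq> 1" by auto
    define v where "v = p ^ (e div 2)"
    have div: "e div 2 > 0" using \<open>e > 0\<close> \<open>e \<noteq> 1\<close> by simp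
    have "v\<^sup>2 \<le> u" using u prime_gt_0_nat[OF u(1)]
      unfolding v_def power_mult[symmetric] by (auto intro!: power_increasing)
    then have "v\<^sup>2 < (s + 1)\<^sup>2" using assms u(5) by linarith
    then have "v < s + 1" by (rule power_less_imp_less_base) simp
    moreover have "v \<ge> 1" using prime_gt_0_nat[OF u(1)] by (simp add: v_def)
    ultimately have v: "v \<in> {1..s}" by simp
    show "u \<in> (\<lambda>v. v\<^sup>2) ` {1..s} \<union> g ` {1..s}"
    proof (cases "even e")
      case True
      then have "u = v\<^sup>2" unfolding v_def u(3) power_mult[symmetric] by simp
      then show ?thesis using v by blast
    next
      case False
      have "u = p ^ (e div 2 * 2 + 1)" unfolding u(3) using False
        by (metis odd_two_times_div_two_succ mult.commute)
      also have "\<dots> = v\<^sup>2 * p" unfolding v_def by (simp add: power_mult)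
      also have "p = aprimedivisor v" using u(1) div by (simp add: v_def aprimedivisor_prime_power)
      finally show ?thesis using v by (auto simp: g_def)
    qed
  qed
  show "finite {u. primepow u \<and> \<not> prime u \<and> u \<le> Z}"
    by (rule finite_subset[OF sub]) simp
  have "card {u. primepow u \<and> \<not> prime u \<and> u \<le> Z} \<le> card ((\<lambda>v. v\<^sup>2) ` {1..s} \<union> g ` {1..s})"
    by (rule card_mono[OF _ sub]) simp
  also have "\<dots> \<le> card ((\<lambda>v. v\<^sup>2) ` {1..s}) + card (g ` {1..s})" by (rule card_Un_le)
  also have "\<dots> \<le> s + s"
    by (intro add_mono order_trans[OF card_image_le]) auto
  finally show "card {u. primepow u \<and> \<not> prime u \<and> u \<le> Z} \<le> 2 * s" by simp
qed

text \<open>The product of two distinct such primes would divide \<open>x\<close> and exceed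
  \<open>M\<^sup>2\<close>.\<close>

lemma card_large_prime_divisors_le_1:
  fixes x M :: nat
  assumes "x > 0" "x \<le> M\<^sup>2"
  shows "card {p. prime p \<and> M < p \<and> p dvd x} \<le> 1"
proof -
  have "p = p'" if "prime p" "M < p" "p dvd x" "prime p'" "M < p'" "p' dvd x" for p p'
  proof (rule ccontr)
    assume "p \<noteq> p'"
    then have "p * p' dvd x" using that by (intro divides_mult) (auto simp: primes_coprime)
    then have "p * p' \<le> x" using assms(1) by (rule dvd_imp_le)
    moreover have "M * M < p * p'" using that by (intro mult_strict_mono) auto
    ultimately show False using assms(2) by (simp add: power2_eq_square)
  qed
  moreover have "finite {p. prime p \<and> M < p \<and> p dvd x}"
    by (rule finite_subset[of _ "{..x}"]) (use assms(1) in \<open>auto dest: dvd_imp_le\<close>)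
  ultimately show ?thesis by (auto simp: card_le_Suc0_iff_eq)
qed

section \<open>Divisor counts summed over a long progression\<close>

text \<open>
  Divisors $u > M$ prime to $X$ are harmless: since all terms are at most $s^2 \le M^2$, each has at most one
  prime divisor above $M$, and each of the at most $2s = M$ proper prime powers up to
  $s^2$ and above $M$ divides at most one of the $M$ terms.
\<close>
lemma sum_card_divisors_bounds:
  fixes X Y s M W :: nat and U T :: "nat set"
  assumes U: "\<And>u. u \<in> U \<Longrightarrow> primepow u"
    and T: "\<And>m. {u\<in>U. \<not> coprime u X \<and> u dvd X * m + Y} = T"
    and Y: "Y > 0" and s: "2 * X + Y \<le> s" and M: "M = 2 * s"
    and W: "W = (\<Sum>u | u \<in> U \<and> coprime u X \<and> u \<le> M. M div u)"
  shows "M * card T + W \<le> (\<Sum>m<M. card {u\<in>U. u dvd X * m + Y})"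
    and "(\<Sum>m<M. card {u\<in>U. u dvd X * m + Y}) \<le> M * card T + W + 3 * M"
proof -
  define small where "small = {u. u \<in> U \<and> coprime u X \<and> u \<le> M}"
  define proper where "proper = {u. u \<in> U \<and> coprime u X \<and> M < u \<and> \<not> prime u \<and> u \<le> s\<^sup>2}"
  define big where "big = (\<lambda>m. {u\<in>U. coprime u X \<and> M < u \<and> u dvd X * m + Y})"
  have pos: "u > 0" if "u \<in> U" for u
    using U[OF that] by (rule primepow_gt_0_nat)
  have fin_dvd: "finite {u\<in>A. u dvd X * m + Y}" for A m
    by (rule finite_subset[of _ "{..X * m + Y}"]) (use Y in \<open>auto dest: dvd_imp_le\<close>)
  have fin_small: "finite small"
    by (rule finite_subset[of _ "{..M}"]) (auto simp: small_def)
  have card_small: "card small \<le> M"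
  proof -
    have "small \<subseteq> {1..M}" using pos by (force simp: small_def)
    from card_mono[OF _ this] show ?thesis by simp
  qed
  have split: "card {u\<in>U. u dvd X * m + Y} = card T + card {u\<in>small. u dvd X * m + Y} + card (big m)" for m
  proof -
    have "{u\<in>U. u dvd X * m + Y} = (T \<union> {u\<in>small. u dvd X * m + Y}) \<union> big m"
      using T[of m] by (auto simp: small_def big_def)
    moreover have "finite T" "finite (big m)"
      using T[of m] fin_dvd[of U m] by (auto simp: big_def intro: finite_subset rev_finite_subset)
    moreover have "T \<inter> {u\<in>small. u dvd X * m + Y} = {}"
      "(T \<union> {u\<in>small. u dvd X * m + Y}) \<inter> big m = {}"
      using T[of m] by (auto simp: small_def big_def)
    ultimately show ?thesis using fin_small by (simp add: card_Un_disjoint)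
  qed
  \<comment> \<open>With \<open>m < 2 * s\<close>, the assumption \<open>2 * X + Y \<le> s\<close>
    gives at most \<open>(2 * X + Y) * s\<close>; this is why the length is tied to
    \<open>s\<close>.\<close>
  have bound: "X * m + Y \<le> s\<^sup>2" if "m < M" for m
  proof -
    have "X * m \<le> X * (2 * s)" using that M by (intro mult_left_mono) auto
    moreover have "Y * 1 \<le> Y * s" using s Y by (intro mult_left_mono) auto
    moreover have "(2 * X + Y) * s \<le> s * s" using s by (rule mult_right_mono) simp
    moreover have "(2 * X + Y) * s = X * (2 * s) + Y * s" by (simp add: algebra_simps)
    ultimately show ?thesis unfolding power2_eq_square by linarith
  qed
  have fin_proper: "finite proper" and card_proper: "card proper \<le> M"
  proof -
    have sub: "proper \<subseteq> {u. primepow u \<and> \<not> prime u \<and> u \<le> s\<^sup>2}"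
      using U by (auto simp: proper_def)
    have lt: "s\<^sup>2 < (s + 1)\<^sup>2" by (simp add: power2_eq_square)
    show "finite proper" by (rule finite_subset[OF sub card_proper_primepow_le(1)[OF lt]])
    show "card proper \<le> M"
      using card_mono[OF card_proper_primepow_le(1)[OF lt] sub] card_proper_primepow_le(2)[OF lt] M
      by linarith
  qed
  have big_le: "card (big m) \<le> 1 + card {u\<in>proper. u dvd X * m + Y}" if "m < M" for m
  proof -
    let ?P = "{p. prime p \<and> M < p \<and> p dvd X * m + Y}"
    have "big m \<subseteq> ?P \<union> {u\<in>proper. u dvd X * m + Y}"
    proof
      fix u assume u: "u \<in> big m"
      then have "u \<le> X * m + Y" using Y by (intro dvd_imp_le) (auto simp: big_def)
      with u bound[OF that] show "u \<in> ?P \<union> {u\<in>proper. u dvd X * m + Y}"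
        by (auto simp: big_def proper_def)
    qed
    moreover have "finite ?P"
      using fin_dvd[of "{p. prime p \<and> M < p}" m] by simp
    ultimately have "card (big m) \<le> card (?P \<union> {u\<in>proper. u dvd X * m + Y})"
      using fin_proper by (intro card_mono) auto
    also have "\<dots> \<le> card ?P + card {u\<in>proper. u dvd X * m + Y}" by (rule card_Un_le)
    also have "card ?P \<le> 1"
    proof (rule card_large_prime_divisors_le_1)
      have "s\<^sup>2 \<le> M\<^sup>2" using M by (intro power_mono) auto
      then show "X * m + Y \<le> M\<^sup>2" using bound[OF that] by linarith
    qed (use Y in simp)
    finally show ?thesis by simp
  qed
  have sum_proper: "(\<Sum>m<M. card {u\<in>proper. u dvd X * m + Y}) \<le> M"
  proof -
    have "(\<Sum>m<M. card {u\<in>proper. u dvd X * m + Y}) = (\<Sum>u\<in>proper. card {m\<in>{..<M}. u dvd X * m + Y})"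
      using fin_proper by (intro sum_card_swap) auto
    also have "\<dots> \<le> (\<Sum>u\<in>proper. 1)"
    proof (rule sum_mono)
      fix u assume "u \<in> proper"
      then have "coprime u X" "u > 0" "M div u = 0" by (auto simp: proper_def)
      then show "card {m\<in>{..<M}. u dvd X * m + Y} \<le> 1"
        using card_dvd_linear_bounds(2)[of u X M Y] by simp
    qed
    finally show ?thesis using card_proper by simp
  qed
  have sum_big: "(\<Sum>m<M. card (big m)) \<le> 2 * M"
  proof -
    have "(\<Sum>m<M. card (big m)) \<le> (\<Sum>m<M. 1 + card {u\<in>proper. u dvd X * m + Y})"
      using big_le by (intro sum_mono) auto
    also have "\<dots> = M + (\<Sum>m<M. card {u\<in>proper. u dvd X * m + Y})"
      by (subst sum.distrib) simp
    finally show ?thesis using sum_proper by linarith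
  qed
  have swap: "(\<Sum>m<M. card {u\<in>small. u dvd X * m + Y}) = (\<Sum>u\<in>small. card {m\<in>{..<M}. u dvd X * m + Y})"
    using fin_small by (intro sum_card_swap) auto
  have W': "W = (\<Sum>u\<in>small. M div u)" using W by (simp add: small_def)
  have ge_small: "W \<le> (\<Sum>m<M. card {u\<in>small. u dvd X * m + Y})"
    unfolding swap W' using card_dvd_linear_bounds(1)[of _ X M Y] pos
    by (intro sum_mono) (auto simp: small_def)
  have "(\<Sum>m<M. card {u\<in>small. u dvd X * m + Y}) \<le> (\<Sum>u\<in>small. M div u + 1)"
    unfolding swap using card_dvd_linear_bounds(2)[of _ X M Y] pos
    by (intro sum_mono) (auto simp: small_def)
  also have "\<dots> = W + card small"
    unfolding W' by (subst sum.distrib) simp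
  finally have le_small: "(\<Sum>m<M. card {u\<in>small. u dvd X * m + Y}) \<le> W + M"
    using card_small by linarith
  have total: "(\<Sum>m<M. card {u\<in>U. u dvd X * m + Y}) =
      M * card T + (\<Sum>m<M. card {u\<in>small. u dvd X * m + Y}) + (\<Sum>m<M. card (big m))"
    unfolding split by (simp add: sum.distrib)
  show "M * card T + W \<le> (\<Sum>m<M. card {u\<in>U. u dvd X * m + Y})"
    unfolding total using ge_small by linarith
  \<comment> \<open>The error \<open>3 * M\<close> consists of a rounding error of at most 1 for
    each of at most \<open>M\<close> small divisors, one large prime per term, and at most
    \<open>M\<close> incidences with proper prime powers.\<close>
  show "(\<Sum>m<M. card {u\<in>U. u dvd X * m + Y}) \<le> M * card T + W + 3 * M"
    unfolding total using le_small sum_big by linarith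
qed

section \<open>Refuting a linear relation in the kernel\<close>

text \<open>Taking the primes or all prime powers for \<open>U\<close> covers both functions. The
  value \<open>s 0\<close> may be arbitrary, since the offsets \<open>r i\<close> keep every
  argument positive.\<close>

lemma not_k_regular_card_divisors:
  fixes U :: "nat set" and s :: "nat \<Rightarrow> int"
  assumes k: "k \<ge> 2"
    and U: "\<And>u. u \<in> U \<Longrightarrow> primepow u" and prime_U: "\<And>p. prime p \<Longrightarrow> p \<in> U"
    and s: "\<And>n. n \<ge> 1 \<Longrightarrow> s n = int (card {u\<in>U. u dvd n})"
  shows "\<not> k_regular k s"
proof
  assume "k_regular k s"
  then obtain G where G: "finite G" "k_kernel k s \<subseteq> int_seq.span G"
    by (auto simp: k_regular_def)
  define d where "d = card G"
  \<comment> \<open>Offsets congruent to 1 modulo \<open>k\<close> make all terms prime to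
    \<open>k\<close>, so the factor \<open>q\<close> of \<open>X\<close> contributes no common
    divisors. The spare offset \<open>R\<close> exceeds those in the relation and will define the
    second class; the exponent \<open>R\<close> in \<open>q\<close> makes all offsets admissible in
    the kernel.\<close>
  define r where "r = (\<lambda>i. 1 + k * i)"
  define R where "R = r (d + 1)"
  define q where "q = k ^ R"
  have r_less: "r i < R" if "i \<le> d" for i
  proof -
    have "k * i < k * (d + 1)" using that k by (intro mult_strict_left_mono) auto
    then show ?thesis by (simp add: r_def R_def)
  qed
  have "R < q" unfolding q_def using k by (intro power_gt_expt) simp
  have "(\<lambda>n. s (q * n + r i)) \<in> int_seq.span G" if "i \<in> {..d}" for i
    using G(2) that r_less[of i] \<open>R < q\<close> by (force simp: k_kernel_def q_def)
  then have "\<exists>c. (\<exists>i\<in>{..d}. c i \<noteq> 0) \<and> (\<forall>n. (\<Sum>i\<le>d. c i * s (q * n + r i)) = 0)"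
    by (intro int_seq_span_dependent[OF G(1)]) (simp_all add: d_def)
  then obtain c where
    c: "\<exists>i\<in>{..d}. c i \<noteq> 0" "\<And>n. (\<Sum>i\<le>d. c i * s (q * n + r i)) = 0"
    by blast
  from c(1) obtain j where j: "j \<le> d" "c j \<noteq> 0" by auto
  \<comment> \<open>Chosen to exceed the total error
    \<open>3 * (\<Sum>i\<le>d. \<bar>c i\<bar>)\<close> of the final comparison by one.\<close>
  define t where "t = nat (3 * (\<Sum>i\<le>d. \<bar>c i\<bar>) + 1)"
  \<comment> \<open>Primes above \<open>R\<close> do not divide \<open>k\<close>, and none divides
    the difference of two distinct offsets up to \<open>R\<close>.\<close>
  have "infinite ({p::nat. prime p} - {..R})"
    using primes_infinite by (intro Diff_infinite_finite) auto
  from infinite_arbitrarily_large[OF this, of t] obtain B where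
    B: "finite B" "card B = t" "B \<subseteq> {p. prime p} - {..R}" by blast
  have B_prime: "prime p" and B_gt: "R < p" if "p \<in> B" for p
    using B(3) that by auto
  define P where "P = \<Prod>B"
  \<comment> \<open>The square of \<open>P\<close> fixes the terms modulo each
    \<open>p\<^sup>2\<close>, hence whether \<open>p\<close> divides them exactly once.\<close>
  define X where "X = q * P\<^sup>2"
  have dvd_P: "p dvd P" if "p \<in> B" for p
    unfolding P_def using B(1) that by (rule dvd_prodI)
  have dvd_X: "p\<^sup>2 dvd X" if "p \<in> B" for p
    unfolding X_def using dvd_P[OF that] by (intro dvd_mult) (simp add: dvd_power_same)
  have P_pos: "P > 0" unfolding P_def using B_prime by (intro prod_pos) (auto simp: prime_gt_0_nat)
  have "coprime q (P\<^sup>2)"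
  proof -
    have "coprime k p" if "p \<in> B" for p
    proof -
      have "k < p" using B_gt[OF that] by (simp add: R_def r_def)
      then have "\<not> p dvd k" using k by (auto dest: dvd_imp_le)
      then show ?thesis using B_prime[OF that] by (metis prime_imp_coprime coprime_commute)
    qed
    then have "coprime k P" unfolding P_def by (intro prod_coprime_right)
    then show ?thesis by (simp add: q_def)
  qed
  then obtain x where x: "[q * x = 1] (mod P\<^sup>2)"
    using cong_solve_coprime_nat[of q "P\<^sup>2"] by auto
  have solve: "[q * (x * (z + (P\<^sup>2 - 1) * y)) + y = z] (mod P\<^sup>2)" for y z
  proof -
    have "[q * (x * (z + (P\<^sup>2 - 1) * y)) + y = 1 * (z + (P\<^sup>2 - 1) * y) + y] (mod P\<^sup>2)"
      unfolding mult.assoc[symmetric] using x by (intro cong_add cong_mult) auto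
    also have "1 * (z + (P\<^sup>2 - 1) * y) + y = z + P\<^sup>2 * y"
    proof -
      obtain w where "P\<^sup>2 = Suc w" using P_pos by (metis gr0_implies_Suc zero_less_power)
      then show ?thesis by simp
    qed
    finally show ?thesis by (simp add: cong_def)
  qed
  \<comment> \<open>In class \<open>a\<close> the term at \<open>r j\<close> is congruent to the
    squarefree \<open>P\<close>, so each prime of \<open>B\<close> divides it exactly once. In class
    \<open>b\<close> these primes all divide the term at the spare offset \<open>R\<close>, and
    therefore none of the terms at \<open>r i\<close> with \<open>i \<le> d\<close>.\<close>
  define a where "a = x * (P + (P\<^sup>2 - 1) * r j)"
  define b where "b = x * (0 + (P\<^sup>2 - 1) * R)"
  have a: "[q * a + r j = P] (mod P\<^sup>2)" unfolding a_def by (rule solve)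
  have b: "[q * b + R = 0] (mod P\<^sup>2)" unfolding b_def by (rule solve)
  have dvd_P2: "p dvd P\<^sup>2" if "p \<in> B" for p
    using dvd_P[OF that] by (simp add: power2_eq_square)
  have dvd_a: "p dvd q * a + r j" if "p \<in> B" for p
    using cong_dvd_iff[OF cong_dvd_modulus_nat[OF a dvd_P2[OF that]]] dvd_P[OF that] by simp
  have dvd_b: "p dvd q * b + R" if "p \<in> B" for p
    using cong_dvd_iff[OF cong_dvd_modulus_nat[OF b dvd_P2[OF that]]] by simp
  have eq_if_dvd: "y = y'" if "p \<in> B" "p dvd z + y" "p dvd z + y'" "y \<le> R" "y' \<le> R" for p z y y'
  proof (rule ccontr)
    have le: "\<not> v < w" if "p dvd z + v" "p dvd z + w" "w \<le> R" for v w
    proof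
      assume "v < w"
      have "p dvd w - v" using dvd_diff_nat[OF that(2,1)] by simp
      with \<open>v < w\<close> have "p \<le> w - v" by (intro dvd_imp_le) auto
      with that B_gt[OF \<open>p \<in> B\<close>] show False by linarith
    qed
    assume "y \<noteq> y'"
    with le[of y y'] le[of y' y] that show False by linarith
  qed
  \<comment> \<open>A prime \<open>p\<close> common to \<open>u\<close> and \<open>X\<close> divides
    \<open>q * n + r i\<close>. It cannot divide \<open>k\<close>, as it would then divide 1; so it
    divides \<open>P\<close> and lies in \<open>B\<close>.\<close>
  have shape: "\<exists>p\<in>B. \<exists>e>0. u = p ^ e \<and> p dvd q * n + r i"
    if u: "u \<in> U" "\<not> coprime u X" "u dvd X * m + (q * n + r i)" for u m n i
  proof -
    obtain p e where p: "prime p" "e > 0" "u = p ^ e"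
      using U[OF u(1)] by (auto simp: primepow_def)
    have "p dvd u" using p by (simp add: dvd_power)
    then have p_dvd: "p dvd X * m + (q * n + r i)" using u(3) by (rule dvd_trans)
    have "\<not> coprime p X" using u(2) p by auto
    then have "p dvd X" using p(1) prime_imp_coprime by blast
    then have p_dvd': "p dvd q * n + r i" using p_dvd by (simp add: dvd_add_right_iff)
    have "\<not> p dvd k"
    proof
      assume "p dvd k"
      moreover from this have "p dvd q * n" using prime_gt_0_nat[OF p(1)]
        unfolding q_def R_def r_def by (simp add: dvd_mult2)
      ultimately have "p dvd 1" using p_dvd'
        unfolding r_def by (metis dvd_add_right_iff dvd_add_left_iff dvd_mult2)
      with p(1) show False by simp
    qed
    then have "\<not> p dvd q" unfolding q_def using p(1) prime_dvd_power by blast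
    with \<open>p dvd X\<close> p(1) have "p dvd P"
      unfolding X_def by (meson prime_dvd_mult_iff prime_dvd_power)
    then obtain p' where "p' \<in> B" "p dvd p'"
      unfolding P_def using B(1) p(1) by (auto simp: prime_dvd_prod_iff)
    then have "p \<in> B" using B_prime p(1) primes_dvd_imp_eq by blast
    with p p_dvd' show ?thesis by blast
  qed
  have sq: "\<not> p\<^sup>2 dvd P" if "p \<in> B" for p
  proof
    assume "p\<^sup>2 dvd P"
    moreover have "P = p * \<Prod>(B - {p})" unfolding P_def using B(1) that by (rule prod.remove)
    ultimately have "p dvd \<Prod>(B - {p})"
      using prime_gt_0_nat[OF B_prime[OF that]] by (simp add: power2_eq_square)
    then obtain p' where "p' \<in> B - {p}" "p dvd p'"
      using B(1) B_prime[OF \<open>p \<in> B\<close>] by (auto simp: prime_dvd_prod_iff)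
    then show False using B_prime that primes_dvd_imp_eq by blast
  qed
  have T_b: "{u\<in>U. \<not> coprime u X \<and> u dvd X * m + (q * b + r i)} = {}" if "i \<le> d" for m i
  proof -
    have False if u: "u \<in> U" "\<not> coprime u X" "u dvd X * m + (q * b + r i)" for u
    proof -
      obtain p where "p \<in> B" "p dvd q * b + r i" using shape[OF u] by blast
      from eq_if_dvd[OF this dvd_b[OF this(1)]] r_less[OF \<open>i \<le> d\<close>] show False by simp
    qed
    then show ?thesis by blast
  qed
  have T_a: "{u\<in>U. \<not> coprime u X \<and> u dvd X * m + (q * a + r i)} = (if i = j then B else {})"
    if "i \<le> d" for m i
  proof (cases "i = j")
    case False
    then have "r i \<noteq> r j" using k by (simp add: r_def)
    have False if u: "u \<in> U" "\<not> coprime u X" "u dvd X * m + (q * a + r i)" for u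
    proof -
      obtain p where "p \<in> B" "p dvd q * a + r i" using shape[OF u] by blast
      from eq_if_dvd[OF this dvd_a[OF this(1)]] r_less[OF \<open>i \<le> d\<close>] r_less[OF j(1)]
      show False using \<open>r i \<noteq> r j\<close> by simp
    qed
    then show ?thesis using False by auto
  next
    case True
    have "p \<in> U \<and> \<not> coprime p X \<and> p dvd X * m + (q * a + r j)" if "p \<in> B" for p
    proof -
      have "p dvd X" using dvd_X[OF that] by (metis dvd_mult_left power2_eq_square)
      then show ?thesis
        using prime_U[OF B_prime[OF that]] dvd_a[OF that] B_prime[OF that]
        by (auto simp: coprime_absorb_left)
    qed
    moreover have "u \<in> B" if u: "u \<in> U" "\<not> coprime u X" "u dvd X * m + (q * a + r j)" for u
    proof -
      obtain p e where p: "p \<in> B" "e > 0" "u = p ^ e" using shape[OF u] by blast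
      \<comment> \<open>Since \<open>p\<^sup>2\<close> divides both \<open>X\<close> and
        \<open>P\<^sup>2\<close>, an exponent above 1 would force \<open>p\<^sup>2\<close> to divide
        \<open>P\<close>.\<close>
      have "e = 1"
      proof (rule ccontr)
        assume "e \<noteq> 1"
        then have "p\<^sup>2 dvd u" using p by (auto intro: le_imp_power_dvd)
        then have "p\<^sup>2 dvd X * m + (q * a + r j)" using u(3) by (rule dvd_trans)
        then have "p\<^sup>2 dvd q * a + r j" using dvd_X[OF p(1)] by (simp add: dvd_add_right_iff)
        moreover have "p\<^sup>2 dvd P\<^sup>2" using dvd_P[OF p(1)] by (simp add: dvd_power_same)
        ultimately have "p\<^sup>2 dvd P" using cong_dvd_iff[OF cong_dvd_modulus_nat[OF a]] by blast
        with sq[OF p(1)] show False by simp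
      qed
      with p show ?thesis by simp
    qed
    ultimately show ?thesis using True by auto
  qed
  \<comment> \<open>One bound serves both classes and all offsets, so \<open>M\<close> and
    \<open>W\<close> are the same throughout.\<close>
  define h where "h = 2 * X + (q * (a + b) + R)"
  define M where "M = 2 * h"
  define W where "W = (\<Sum>u | u \<in> U \<and> coprime u X \<and> u \<le> M. M div u)"
  define S where "S = (\<lambda>n i. \<Sum>m<M. card {u\<in>U. u dvd X * m + (q * n + r i)})"
  have S_a: "M * (if i = j then t else 0) + W \<le> S a i"
    "S a i \<le> M * (if i = j then t else 0) + W + 3 * M" if "i \<le> d" for i
  proof -
    have le: "2 * X + (q * a + r i) \<le> h" using r_less[OF that] by (simp add: h_def algebra_simps)
    have pos: "0 < q * a + r i" by (simp add: r_def)
    have "card (if i = j then B else {}) = (if i = j then t else 0)" using B(2) by simp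
    with sum_card_divisors_bounds[OF U T_a[OF that] pos le M_def W_def]
    show "M * (if i = j then t else 0) + W \<le> S a i"
      "S a i \<le> M * (if i = j then t else 0) + W + 3 * M"
      unfolding S_def by simp_all
  qed
  have S_b: "W \<le> S b i" "S b i \<le> W + 3 * M" if "i \<le> d" for i
  proof -
    have le: "2 * X + (q * b + r i) \<le> h" using r_less[OF that] by (simp add: h_def algebra_simps)
    have pos: "0 < q * b + r i" by (simp add: r_def)
    from sum_card_divisors_bounds[OF U T_b[OF that] pos le M_def W_def]
    show "W \<le> S b i" "S b i \<le> W + 3 * M" unfolding S_def by simp_all
  qed
  have sum_S: "(\<Sum>i\<le>d. c i * int (S n i)) = 0" for n
  proof -
    \<comment> \<open>Because \<open>X = q * P\<^sup>2\<close>, stepping by \<open>X\<close> shifts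
      the argument of the relation by \<open>P\<^sup>2\<close>, so the sum consists of
      \<open>M\<close> instances of the relation.\<close>
    have "(\<Sum>i\<le>d. c i * int (S n i)) = (\<Sum>i\<le>d. \<Sum>m<M. c i * s (q * (n + P\<^sup>2 * m) + r i))"
    proof (intro sum.cong refl)
      fix i
      have "int (card {u\<in>U. u dvd X * m + (q * n + r i)}) = s (q * (n + P\<^sup>2 * m) + r i)" for m
      proof -
        have "X * m + (q * n + r i) = q * (n + P\<^sup>2 * m) + r i" by (simp add: X_def algebra_simps)
        moreover have "q * (n + P\<^sup>2 * m) + r i \<ge> 1" by (simp add: r_def)
        ultimately show ?thesis using s by metis
      qed
      then show "c i * int (S n i) = (\<Sum>m<M. c i * s (q * (n + P\<^sup>2 * m) + r i))"
        by (simp add: S_def sum_distrib_left)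
    qed
    also have "\<dots> = (\<Sum>m<M. \<Sum>i\<le>d. c i * s (q * (n + P\<^sup>2 * m) + r i))" by (rule sum.swap)
    also have "\<dots> = 0" by (simp only: c(2) sum.neutral_const)
    finally show ?thesis .
  qed
  \<comment> \<open>The deviation from the main term: \<open>W\<close> cancels in the difference,
    and both sums lie in windows of width \<open>3 * M\<close>.\<close>
  define \<delta> where "\<delta> = (\<lambda>i. int (S a i) - int (S b i) - int M * (if i = j then int t else 0))"
  have \<delta>: "\<bar>\<delta> i\<bar> \<le> 3 * int M" if "i \<le> d" for i
  proof -
    have "int (M * (if i = j then t else 0)) = int M * (if i = j then int t else 0)" by simp
    then show ?thesis using S_a[OF that] S_b[OF that] unfolding \<delta>_def by linarith
  qed
  have "(\<Sum>i\<le>d. c i * \<delta> i) =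
      (\<Sum>i\<le>d. c i * int (S a i)) - (\<Sum>i\<le>d. c i * int (S b i)) - (\<Sum>i\<le>d. if i = j then c i * (int M * int t) else 0)"
    unfolding sum_subtractf[symmetric] by (intro sum.cong) (auto simp: \<delta>_def algebra_simps)
  also have "\<dots> = - (c j * (int M * int t))" using j(1) by (simp add: sum_S)
  finally have "\<bar>c j\<bar> * (int M * int t) = \<bar>\<Sum>i\<le>d. c i * \<delta> i\<bar>" by (simp add: abs_mult)
  also have "\<dots> \<le> (\<Sum>i\<le>d. \<bar>c i\<bar> * \<bar>\<delta> i\<bar>)" unfolding abs_mult[symmetric] by (rule sum_abs)
  also have "\<dots> \<le> (\<Sum>i\<le>d. \<bar>c i\<bar> * (3 * int M))"
    using \<delta> by (intro sum_mono mult_left_mono) auto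
  also have "\<dots> = int M * (3 * (\<Sum>i\<le>d. \<bar>c i\<bar>))" by (simp add: sum_distrib_left mult_ac)
  finally have "int M * (\<bar>c j\<bar> * int t) \<le> int M * (3 * (\<Sum>i\<le>d. \<bar>c i\<bar>))" by (simp add: mult_ac)
  moreover have "M > 0" by (simp add: M_def h_def R_def r_def)
  \<comment> \<open>Cancelling \<open>M\<close> leaves a bound free of the progression; with
    \<open>c j\<close> a nonzero integer it gives \<open>t \<le> t - 1\<close>.\<close>
  ultimately have "\<bar>c j\<bar> * int t \<le> 3 * (\<Sum>i\<le>d. \<bar>c i\<bar>)" by simp
  moreover have "1 * int t \<le> \<bar>c j\<bar> * int t" using j(2) by (intro mult_right_mono) auto
  moreover have "int t = 3 * (\<Sum>i\<le>d. \<bar>c i\<bar>) + 1" unfolding t_def by (simp add: sum_nonneg)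
  ultimately show False by linarith
qed

(* The sequences start at n = 1, whereas the kernel is formed from sequences on all of nat:
   s ranges over all extensions to n = 0, so no convention for the value at 0 is imposed. *)
theorem theorem3p5:
  fixes k :: nat
  assumes "k \<ge> 2"
  shows "(\<forall>s. (\<forall>n\<ge>1. s n = int (little_omega n)) \<longrightarrow> \<not> k_regular k s) \<and>
         (\<forall>s. (\<forall>n\<ge>1. s n = int (big_omega n)) \<longrightarrow> \<not> k_regular k s)"
proof (intro conjI allI impI)
  fix s assume "\<forall>n\<ge>1. s n = int (little_omega n)"
  then show "\<not> k_regular k s"
    using not_k_regular_card_divisors[of k "{u. prime u}" s] assms
    by (simp add: little_omega_eq_card)
next
  fix s assume "\<forall>n\<ge>1. s n = int (big_omega n)"
  then show "\<not> k_regular k s"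
    using not_k_regular_card_divisors[of k "{u. primepow u}" s] assms
    by (simp add: big_omega_eq_card)
qed

end
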